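(* Let $K$ and $M$ be integers with $2\le M\le K$, let $q$ be a prime power with $q\ge K$, and let $l\ge 1$ be an integer. The Modified Specialized GRS Code protocol (with parameters $K,M,q,l$) is a scalar-linear PIR-PCSI--II protocol, and achieves the rate $(K-M+1)^{-1}$.
   Context: Setup. Let $\mathcal{K}=\{1,\dots,K\}$, $\mathbb{F}_q^{\times}=\mathbb{F}_q\setminus\{0\}$ and $L=l\log_2 q$. Let $\mathcal{S}$ be the set of all $M$-subsets of $\mathcal{K}$ and $\mathcal{C}$ the set of all length-$M$ sequences over $\mathbb{F}_q^{\times}$. Boldface denotes random variables, regular letters their realizations; entropies are in bits. A server stores messages $\mathbf{X}_1,\dots,\mathbf{X}_K$, i.i.d. uniform on $\mathbb{F}_{q^l}$; write $\mathbf{X}_{\mathcal{K}}=\{\mathbf{X}_1,\dots,\mathbf{X}_K\}$. A user wants $X_W$ ($W\in\mathcal{K}$) and knows $Y^{[S,C]}=\sum_{i\in S}c_iX_i$, where $S=\{i_1,\dots,i_M\}\in\mathcal{S}$ and $C=(c_{i_1},\dots,c_{i_M})\in\mathcal{C}$. $\mathbf{S}$ is uniform on $\mathcal{S}$, $\mathbf{C}$ is uniform on $\mathcal{C}$ and independent of $(\mathbf{W},\mathbf{S})$, and the messages are independent of $(\mathbf{W},\mathbf{S},\mathbf{C})$. Model II: given $\mathbf{S}=S$, $\mathbf{W}$ is uniform on $S$ (so the indicator $\mathds{1}_{\{\mathbf{W}\in\mathbf{S}\}}$ equals $1$). A protocol consists of a query $\mathbf{Q}$, a possibly stochastic function of $(\mathbf{W},\mathbf{S},\mathbf{C})$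 only (extra randomness independent of the messages), and an answer $\mathbf{A}$, a deterministic function of $\mathbf{Q}$, $\mathds{1}_{\{\mathbf{W}\in\mathbf{S}\}}$ and $\mathbf{X}_{\mathcal{K}}$. It is a PIR-PCSI--II protocol if, under Model II, it satisfies recoverability, $H(\mathbf{X}_{\mathbf{W}}\mid \mathbf{A},\mathbf{Q},\mathds{1}_{\{\mathbf{W}\in\mathbf{S}\}},\mathbf{Y}^{[\mathbf{S},\mathbf{C}]},\mathbf{W},\mathbf{S},\mathbf{C})=0$, and $(W,S)$-privacy, $I(\mathbf{W},\mathbf{S};\mathbf{Q}\mid \mathds{1}_{\{\mathbf{W}\in\mathbf{S}\}})=0$ (equivalently, for every query $Q$ of positive probability the conditional distribution of $(\mathbf{W},\mathbf{S})$ given $\mathbf{Q}=Q$ equals its prior distribution under Model II). Its rate is $L/H(\mathbf{A}\mid \mathds{1}_{\{\mathbf{W}\in\mathbf{S}\}}=1)$. It is scalar-linear if the answer consists only of linear combinations of $X_1,\dots,X_K$ with scalar coefficients (in $\mathbb{F}_q$). Modified Specialized GRS Code protocol. Fix $K$ distinct elements $\omega_1,\dots,\omega_K\in\mathbb{F}_q$ (chosen arbitrarily, not depending on $W,S,C$, and known to the server). Step 1: given $W,S,C$ with $W\in S$, the user forms $p(x)=\prod_{i\in\mathcal{K}\setminus S}(x-\omega_i)=\sum_{i=1}^{K-M+1}p_ix^{i-1}$. For $j\in S\setminus\{W\}$ put $v_j=c_j/p(\omega_j)$; put $v_W=c/p(\omega_W)$ where $c$ is chosen uniformly at random from $\mathbb{F}_q^{\times}\setminus\{c_W\}$;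 for $j\notin S$ choose $v_j$ uniformly at random from $\mathbb{F}_q^{\times}$ (all random choices mutually independent). For $i=1,\dots,K-M+1$ let $Q_i=(v_1\omega_1^{i-1},\dots,v_K\omega_K^{i-1})$ (with $0^0=1$). The query is $Q=(Q_1,\dots,Q_{K-M+1})$. Step 2: the server returns $A=(A_1,\dots,A_{K-M+1})$ with $A_i=\sum_{j=1}^{K}v_j\omega_j^{i-1}X_j$. Step 3: the user computes $\sum_{i=1}^{K-M+1}p_iA_i=cX_W+\sum_{i\in S\setminus\{W\}}c_iX_i$, subtracts $Y^{[S,C]}$, and recovers $X_W$ from the remaining multiple $(c-c_W)X_W$.
   Formalization: The formal statement adds q ≥ 3; this excludes only q = K = M = 2, where the set F_q^× \ {c_W} from which c is to be drawn is empty, so the protocol is undefined. *)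

theory Defs
  imports
    "HOL-Probability.Probability"
    "HOL-Computational_Algebra.Polynomial"
    "HOL-Number_Theory.Prime_Powers"
begin

section \<open>Entropies, in bits, of discrete random variables\<close>

text \<open>
  The library's discrete notations for entropy, conditional entropy and conditional mutual
  information range over the image of the whole sample space. The sample space of a pmf is
  therefore cut down to its support; this only removes a null set.
\<close>

definition support_space :: "'o pmf \<Rightarrow> 'o measure" where
  "support_space p = restrict_space (measure_pmf p) (set_pmf p)"

lemma space_support_space [simp]: "space (support_space p) = set_pmf p"
  by (simp add: support_space_def space_restrict_space)

lemma information_space_support_space: "information_space (support_space p) 2"
proof -
  have "prob_space (support_space p)"
    unfolding support_space_def
    by (rule prob_space_restrict_space) (auto simp: measure_pmf.emeasure_eq_measure measure_pmf.prob_eq_1 AE_measure_pmf)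
  then show ?thesis
    by (simp add: information_space_def information_space_axioms_def)
qed

definition bit_entropy :: "'o pmf \<Rightarrow> ('o \<Rightarrow> 'a) \<Rightarrow> real" where
  "bit_entropy p X = prob_space.entropy (support_space p) 2 (count_space (X ` set_pmf p)) X"

definition bit_cond_entropy :: "'o pmf \<Rightarrow> ('o \<Rightarrow> 'a) \<Rightarrow> ('o \<Rightarrow> 'b) \<Rightarrow> real" where
  "bit_cond_entropy p X Y = prob_space.conditional_entropy (support_space p) 2
     (count_space (X ` set_pmf p)) (count_space (Y ` set_pmf p)) X Y"

definition bit_cond_mutual_information ::
    "'o pmf \<Rightarrow> ('o \<Rightarrow> 'a) \<Rightarrow> ('o \<Rightarrow> 'b) \<Rightarrow> ('o \<Rightarrow> 'c) \<Rightarrow> real" where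
  "bit_cond_mutual_information p X Y Z = prob_space.conditional_mutual_information (support_space p) 2
     (count_space (X ` set_pmf p)) (count_space (Y ` set_pmf p)) (count_space (Z ` set_pmf p)) X Y Z"


section \<open>Private information retrieval with private coded side information\<close>

text \<open>
  The type \<open>'f\<close> is the field with \<open>q\<close> elements and \<open>'e\<close> its extension of degree \<open>l\<close>;
  the inclusion of the former in the latter is an explicit map.
\<close>

definition field_embedding :: "('f::field \<Rightarrow> 'e::field) \<Rightarrow> bool" where
  "field_embedding emb \<longleftrightarrow> emb 1 = 1 \<and>
     (\<forall>a b. emb (a + b) = emb a + emb b) \<and> (\<forall>a b. emb (a * b) = emb a * emb b)"

definition M_subsets :: "nat \<Rightarrow> nat \<Rightarrow> nat set set" where
  "M_subsets K M = {S. S \<subseteq> {1..K} \<and> card S = M}"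

definition coef_seqs :: "nat \<Rightarrow> 'f::field list set" where
  "coef_seqs M = {C. length C = M \<and> set C \<subseteq> UNIV - {0}}"

text \<open>
  For \<open>S = {i\<^sub>1 < \<dots> < i\<^sub>M}\<close> the sequence \<open>C\<close> is \<open>(c\<^bsub>i\<^sub>1\<^esub>, \<dots>, c\<^bsub>i\<^sub>M\<^esub>)\<close>;
  \<open>coef S C i\<close> is \<open>c\<^sub>i\<close> for \<open>i \<in> S\<close>.
\<close>

definition coef :: "nat set \<Rightarrow> 'f list \<Rightarrow> nat \<Rightarrow> 'f" where
  "coef S C i = the (map_of (zip (sorted_list_of_set S) C) i)"

definition side_info ::
    "('f \<Rightarrow> 'e::field) \<Rightarrow> nat set \<Rightarrow> 'f list \<Rightarrow> (nat \<Rightarrow> 'e) \<Rightarrow> 'e" where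
  "side_info emb S C X = (\<Sum>i\<in>S. emb (coef S C i) * X i)"

text \<open>
  The query is drawn from a distribution determined by \<open>W\<close>, \<open>S\<close>, \<open>C\<close>. The answer is a
  deterministic function of the query, the indicator of \<open>W \<in> S\<close>, and the messages.
\<close>

record ('f, 'e, 'q, 'a) protocol =
  query :: "nat \<Rightarrow> nat set \<Rightarrow> 'f list \<Rightarrow> 'q pmf"
  answer :: "'q \<Rightarrow> bool \<Rightarrow> (nat \<Rightarrow> 'e) \<Rightarrow> 'a"

text \<open>Messages are functions on \<open>{1..K}\<close>, set to \<open>0\<close> at all other indices.\<close>

definition messages :: "nat \<Rightarrow> (nat \<Rightarrow> 'e::{finite,field}) pmf" where
  "messages K = Pi_pmf {1..K} 0 (\<lambda>_. pmf_of_set UNIV)"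

type_synonym ('f, 'e, 'q) outcome = "nat \<times> nat set \<times> 'f list \<times> (nat \<Rightarrow> 'e) \<times> 'q"

text \<open>The joint law of \<open>(W, S, C, X, Q)\<close> under Model II.\<close>

definition model_II ::
    "nat \<Rightarrow> nat \<Rightarrow> ('f::{finite,field}, 'e::{finite,field}, 'q, 'a) protocol \<Rightarrow>
     ('f, 'e, 'q) outcome pmf" where
  "model_II K M P = do {
     S \<leftarrow> pmf_of_set (M_subsets K M);
     W \<leftarrow> pmf_of_set S;
     C \<leftarrow> pmf_of_set (coef_seqs M);
     X \<leftarrow> messages K;
     Q \<leftarrow> query P W S C;
     return_pmf (W, S, C, X, Q)
   }"

definition rv_ind :: "('f, 'e, 'q) outcome \<Rightarrow> bool" where
  "rv_ind = (\<lambda>(W, S, C, X, Q). W \<in> S)"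

definition rv_answer :: "('f, 'e, 'q, 'a) protocol \<Rightarrow> ('f, 'e, 'q) outcome \<Rightarrow> 'a" where
  "rv_answer P = (\<lambda>(W, S, C, X, Q). answer P Q (W \<in> S) X)"

definition recoverable ::
    "nat \<Rightarrow> nat \<Rightarrow> ('f::{finite,field} \<Rightarrow> 'e::{finite,field}) \<Rightarrow>
     ('f, 'e, 'q, 'a) protocol \<Rightarrow> bool" where
  "recoverable K M emb P \<longleftrightarrow>
     bit_cond_entropy (model_II K M P)
       (\<lambda>(W, S, C, X, Q). X W)
       (\<lambda>(W, S, C, X, Q). (answer P Q (W \<in> S) X, Q, W \<in> S, side_info emb S C X, W, S, C)) = 0"

definition WS_private ::
    "nat \<Rightarrow> nat \<Rightarrow> ('f::{finite,field}, 'e::{finite,field}, 'q, 'a) protocol \<Rightarrow> bool" where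
  "WS_private K M P \<longleftrightarrow>
     bit_cond_mutual_information (model_II K M P)
       (\<lambda>(W, S, C, X, Q). (W, S)) (\<lambda>(W, S, C, X, Q). Q) rv_ind = 0"

definition PIR_PCSI_II_protocol ::
    "nat \<Rightarrow> nat \<Rightarrow> ('f::{finite,field} \<Rightarrow> 'e::{finite,field}) \<Rightarrow>
     ('f, 'e, 'q, 'a) protocol \<Rightarrow> bool" where
  "PIR_PCSI_II_protocol K M emb P \<longleftrightarrow> recoverable K M emb P \<and> WS_private K M P"

text \<open>\<open>L / H(A | 1\<^bsub>W \<in> S\<^esub> = 1)\<close> with \<open>L = l log\<^sub>2 q\<close>.\<close>

definition rate ::
    "nat \<Rightarrow> nat \<Rightarrow> nat \<Rightarrow> nat \<Rightarrow> ('f::{finite,field}, 'e::{finite,field}, 'q, 'a) protocol \<Rightarrow> real" where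
  "rate K M q l P = (real l * log 2 (real q)) /
     bit_entropy (cond_pmf (model_II K M P) {\<omega>. rv_ind \<omega>}) (rv_answer P)"

definition scalar_linear ::
    "nat \<Rightarrow> ('f \<Rightarrow> 'e::field) \<Rightarrow> ('f, 'e, 'q, 'e list) protocol \<Rightarrow> bool" where
  "scalar_linear K emb P \<longleftrightarrow>
     (\<forall>Q b. \<exists>as :: (nat \<Rightarrow> 'f) list. \<forall>X.
        answer P Q b X = map (\<lambda>a. \<Sum>j=1..K. emb (a j) * X j) as)"


section \<open>The Modified Specialized GRS Code protocol\<close>

definition GRS_poly :: "nat \<Rightarrow> (nat \<Rightarrow> 'f::field) \<Rightarrow> nat set \<Rightarrow> 'f poly" where
  "GRS_poly K \<omega> S = (\<Prod>i\<in>{1..K} - S. [:- \<omega> i, 1:])"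

text \<open>The \<open>i\<close>-th list is \<open>(v\<^sub>1 \<omega>\<^sub>1\<^bsup>i-1\<^esup>, \<dots>, v\<^sub>K \<omega>\<^sub>K\<^bsup>i-1\<^esup>)\<close>.\<close>

definition GRS_rows ::
    "nat \<Rightarrow> nat \<Rightarrow> (nat \<Rightarrow> 'f::field) \<Rightarrow> (nat \<Rightarrow> 'f) \<Rightarrow> 'f list list" where
  "GRS_rows K M \<omega> v =
     map (\<lambda>i. map (\<lambda>j. v j * \<omega> j ^ (i - 1)) [1..<K + 1]) [1..<K - M + 2]"

text \<open>
  The step \<open>c \<leftarrow> pmf_of_set (UNIV - {0, c\<^sub>W})\<close> is meaningful only for \<open>q \<ge> 3\<close>:
  over the field with two elements the set is empty and \<open>pmf_of_set\<close> is unspecified.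
\<close>

definition GRS_query ::
    "nat \<Rightarrow> nat \<Rightarrow> (nat \<Rightarrow> 'f::{finite,field}) \<Rightarrow> nat \<Rightarrow> nat set \<Rightarrow> 'f list \<Rightarrow> 'f list list pmf" where
  "GRS_query K M \<omega> W S C = do {
     c \<leftarrow> pmf_of_set (UNIV - {0, coef S C W});
     u \<leftarrow> Pi_pmf ({1..K} - S) 0 (\<lambda>_. pmf_of_set (UNIV - {0}));
     let v = (\<lambda>j. if j = W then c / poly (GRS_poly K \<omega> S) (\<omega> W)
                  else if j \<in> S then coef S C j / poly (GRS_poly K \<omega> S) (\<omega> j)
                  else u j);
     return_pmf (GRS_rows K M \<omega> v)
   }"

text \<open>
  The \<open>j\<close>-th entry of the \<open>i\<close>-th row of the query is \<open>v\<^sub>j \<omega>\<^sub>j\<^bsup>i-1\<^esup>\<close>, so the server computes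
  \<open>A\<^sub>i = (\<Sum>j. v\<^sub>j \<omega>\<^sub>j\<^bsup>i-1\<^esup> X\<^sub>j)\<close> as the inner product of that row with the messages.
\<close>

definition GRS_answer ::
    "nat \<Rightarrow> ('f \<Rightarrow> 'e::field) \<Rightarrow> 'f list list \<Rightarrow> bool \<Rightarrow> (nat \<Rightarrow> 'e) \<Rightarrow> 'e list" where
  "GRS_answer K emb Q b X = map (\<lambda>row. \<Sum>j=1..K. emb (row ! (j - 1)) * X j) Q"

definition modified_specialized_GRS ::
    "nat \<Rightarrow> nat \<Rightarrow> ('f::{finite,field} \<Rightarrow> 'e::field) \<Rightarrow> (nat \<Rightarrow> 'f) \<Rightarrow>
     ('f, 'e, 'f list list, 'e list) protocol" where
  "modified_specialized_GRS K M emb \<omega> =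
     \<lparr>query = GRS_query K M \<omega>, answer = GRS_answer K emb\<rparr>"

end

theory Submission
  imports Defs
begin

text \<open>
  Given \<open>(W, S)\<close>, the vector \<open>v\<close> is uniform on the vectors with nonzero entries: off \<open>W\<close> this is
  immediate, and \<open>v\<^sub>W\<close> is a nonzero multiple of a uniform nonzero element different from the
  uniform element \<open>c\<^sub>W\<close>, which is again uniform once \<open>c\<^sub>W\<close> is averaged out. So the query, a function
  of \<open>v\<close>, is independent of \<open>(W, S)\<close>.

  For every polynomial \<open>p\<close> of degree at most \<open>K - M\<close>, the combination of the answers with the
  coefficients of \<open>p\<close> is \<open>\<Sum>j. v\<^sub>j p(\<omega>\<^sub>j) X\<^sub>j\<close>. Taking the roots of \<open>p\<close> to be the \<open>\<omega>\<^sub>i\<close> with \<open>i \<notin> S\<close> gives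
  recoverability. Polynomials vanishing at all but one of \<open>\<omega>\<^sub>1, \<dots>, \<omega>\<^sub>n\<close>, \<open>n = K - M + 1\<close>, show that
  for fixed \<open>X\<^sub>i\<close>, \<open>i > n\<close>, the answer determines \<open>X\<^sub>1, \<dots>, X\<^sub>n\<close>; hence it is uniform on
  the sequences of length \<open>n\<close>.
\<close>

section \<open>Entropies of variables with finite support\<close>

lemma prob_space_support_space: "prob_space (support_space p)"
  using information_space_support_space[of p] by (simp add: information_space_def)

lemma sets_support_space [simp]: "sets (support_space p) = Pow (set_pmf p)"
  by (auto simp: support_space_def sets_restrict_space)

lemma measure_support_space: "A \<subseteq> set_pmf p \<Longrightarrow> measure (support_space p) A = measure_pmf.prob p A"
  by (simp add: support_space_def measure_restrict_space)

text \<open>The form that the finite-sum formulas for entropies require. Every function is simple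
  here, because the space is finite and all its subsets are measurable.\<close>

lemma simple_distributed_support_space:
  assumes "finite (set_pmf p)"
  shows "simple_distributed (support_space p) X (pmf (map_pmf X p))"
proof -
  interpret prob_space "support_space p" by (rule prob_space_support_space)
  show ?thesis
  proof (rule simple_distributedI)
    show "simple_function (support_space p) X"
      using assms by (simp add: simple_function_def)
    fix x
    show "pmf (map_pmf X p) x = measure (support_space p) (X -` {x} \<inter> space (support_space p))"
      by (simp add: measure_support_space pmf_map measure_Int_set_pmf)
  qed simp
qed

lemma bit_entropy_uniform:
  assumes "finite (set_pmf p)" and "map_pmf X p = pmf_of_set A" and "finite A" and "A \<noteq> {}"
  shows "bit_entropy p X = log 2 (card A)"
proof -
  interpret information_space "support_space p" 2 by (rule information_space_support_space)
  have img: "X ` set_pmf p = A"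
    using arg_cong[OF assms(2), of set_pmf] assms(3,4) by simp
  have "bit_entropy p X = - (\<Sum>x\<in>A. pmf (pmf_of_set A) x * log 2 (pmf (pmf_of_set A) x))"
    using entropy_simple_distributed[OF simple_distributed_support_space[OF assms(1), of X]]
    by (simp add: bit_entropy_def img assms(2))
  also have "\<dots> = log 2 (card A)"
    using assms(3,4) by (simp add: log_divide)
  finally show ?thesis .
qed

text \<open>The event \<open>Y = y\<close> already forces \<open>X = f y\<close>, so the joint and
  the marginal probabilities agree and every logarithm is that of 1.\<close>

lemma bit_cond_entropy_eq_0:
  assumes "finite (set_pmf p)" and f: "\<And>\<omega>. \<omega> \<in> set_pmf p \<Longrightarrow> X \<omega> = f (Y \<omega>)"
  shows "bit_cond_entropy p X Y = 0"
proof -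
  interpret information_space "support_space p" 2 by (rule information_space_support_space)
  have eq: "pmf (map_pmf (\<lambda>\<omega>. (X \<omega>, Y \<omega>)) p) (f y, y) = pmf (map_pmf Y p) y" for y
    unfolding pmf_map by (rule measure_pmf.finite_measure_eq_AE) (auto simp: AE_measure_pmf_iff f)
  have "bit_cond_entropy p X Y = - (\<Sum>(x, y)\<in>(\<lambda>\<omega>. (X \<omega>, Y \<omega>)) ` set_pmf p.
      pmf (map_pmf (\<lambda>\<omega>. (X \<omega>, Y \<omega>)) p) (x, y) *
      log 2 (pmf (map_pmf (\<lambda>\<omega>. (X \<omega>, Y \<omega>)) p) (x, y) / pmf (map_pmf Y p) y))"
    using conditional_entropy_eq[OF simple_distributed_support_space[OF assms(1), of Y]
        simple_distributed_support_space[OF assms(1), of "\<lambda>\<omega>. (X \<omega>, Y \<omega>)"]]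
    by (simp add: bit_cond_entropy_def)
  also have "\<dots> = - (\<Sum>(x, y)\<in>(\<lambda>\<omega>. (X \<omega>, Y \<omega>)) ` set_pmf p. 0)"
  proof (intro arg_cong[where f = uminus] sum.cong refl, safe)
    fix \<omega> assume "\<omega> \<in> set_pmf p"
    then show "pmf (map_pmf (\<lambda>\<omega>. (X \<omega>, Y \<omega>)) p) (X \<omega>, Y \<omega>) *
      log 2 (pmf (map_pmf (\<lambda>\<omega>. (X \<omega>, Y \<omega>)) p) (X \<omega>, Y \<omega>) / pmf (map_pmf Y p) (Y \<omega>)) = 0"
      by (simp add: f eq pmf_eq_0_set_pmf)
  qed
  finally show ?thesis by (simp add: split_beta')
qed

text \<open>Conditioning on a constant changes no law, so independence of \<open>X\<close> and
  \<open>Y\<close> makes the argument of each logarithm 1 on the support.\<close>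

lemma bit_cond_mutual_information_eq_0:
  assumes "finite (set_pmf p)" and Z: "\<And>\<omega>. \<omega> \<in> set_pmf p \<Longrightarrow> Z \<omega> = z"
    and indep: "map_pmf (\<lambda>\<omega>. (X \<omega>, Y \<omega>)) p = pair_pmf P Q"
  shows "bit_cond_mutual_information p X Y Z = 0"
proof -
  interpret information_space "support_space p" 2 by (rule information_space_support_space)
  have X: "map_pmf (\<lambda>\<omega>. (X \<omega>, Z \<omega>)) p = map_pmf (\<lambda>x. (x, z)) P"
  proof -
    have "map_pmf (\<lambda>\<omega>. (X \<omega>, Z \<omega>)) p = map_pmf (\<lambda>(x, y). (x, z)) (map_pmf (\<lambda>\<omega>. (X \<omega>, Y \<omega>)) p)"
      unfolding pmf.map_comp by (rule map_pmf_cong) (auto simp: Z)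
    also have "\<dots> = map_pmf (\<lambda>x. (x, z)) (map_pmf fst (pair_pmf P Q))"
      by (simp add: indep pmf.map_comp o_def split_beta')
    finally show ?thesis by (simp add: map_fst_pair_pmf)
  qed
  have Y: "map_pmf (\<lambda>\<omega>. (Y \<omega>, Z \<omega>)) p = map_pmf (\<lambda>y. (y, z)) Q"
  proof -
    have "map_pmf (\<lambda>\<omega>. (Y \<omega>, Z \<omega>)) p = map_pmf (\<lambda>(x, y). (y, z)) (map_pmf (\<lambda>\<omega>. (X \<omega>, Y \<omega>)) p)"
      unfolding pmf.map_comp by (rule map_pmf_cong) (auto simp: Z)
    also have "\<dots> = map_pmf (\<lambda>y. (y, z)) (map_pmf snd (pair_pmf P Q))"
      by (simp add: indep pmf.map_comp o_def split_beta')
    finally show ?thesis by (simp add: map_snd_pair_pmf)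
  qed
  have XY: "map_pmf (\<lambda>\<omega>. (X \<omega>, Y \<omega>, Z \<omega>)) p = map_pmf (\<lambda>(x, y). (x, y, z)) (pair_pmf P Q)"
    unfolding indep[symmetric] pmf.map_comp by (rule map_pmf_cong) (auto simp: Z)
  have Z1: "map_pmf Z p = return_pmf z"
    using Z by (simp add: map_pmf_cong map_pmf_const cong: map_pmf_cong)
  \<comment> \<open>Appending the constant \<open>z\<close> is injective and therefore preserves
    point probabilities.\<close>
  have inj: "pmf (map_pmf (\<lambda>x. (x, z)) P) (x, z) = pmf P x"
    "pmf (map_pmf (\<lambda>x. (x, z)) Q) (y, z) = pmf Q y"
    "pmf (map_pmf (\<lambda>(x, y). (x, y, z)) (pair_pmf P Q)) (x, y, z) = pmf P x * pmf Q y" for x y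
    using pmf_map_inj'[of "\<lambda>x. (x, z)" P x] pmf_map_inj'[of "\<lambda>x. (x, z)" Q y]
      pmf_map_inj'[of "\<lambda>(x, y). (x, y, z)" "pair_pmf P Q" "(x, y)"]
    by (auto simp: inj_def pmf_pair)
  have "bit_cond_mutual_information p X Y Z = (\<Sum>(x, y, z)\<in>(\<lambda>\<omega>. (X \<omega>, Y \<omega>, Z \<omega>)) ` set_pmf p.
      pmf (map_pmf (\<lambda>\<omega>. (X \<omega>, Y \<omega>, Z \<omega>)) p) (x, y, z) *
      log 2 (pmf (map_pmf (\<lambda>\<omega>. (X \<omega>, Y \<omega>, Z \<omega>)) p) (x, y, z) /
        (pmf (map_pmf (\<lambda>\<omega>. (X \<omega>, Z \<omega>)) p) (x, z) *
         (pmf (map_pmf (\<lambda>\<omega>. (Y \<omega>, Z \<omega>)) p) (y, z) / pmf (map_pmf Z p) z))))"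
    unfolding bit_cond_mutual_information_def
    by (rule conditional_mutual_information_eq[OF
          simple_distributed_support_space[OF assms(1)] simple_distributed_support_space[OF assms(1)]
          simple_distributed_support_space[OF assms(1)] simple_distributed_support_space[OF assms(1)],
          unfolded space_support_space])
  also have "\<dots> = (\<Sum>(x, y, z)\<in>(\<lambda>\<omega>. (X \<omega>, Y \<omega>, Z \<omega>)) ` set_pmf p. 0)"
    by (intro sum.cong refl) (auto simp: Z X Y XY Z1 inj)
  finally show ?thesis by (simp add: split_beta')
qed

section \<open>Answers as evaluations of polynomials\<close>

lemma nonzero_set_nonempty: "UNIV - {0 :: 'f::zero_neq_one} \<noteq> {}"
  using zero_neq_one[where 'a = 'f] by (metis DiffI UNIV_I empty_iff singletonD)

section \<open>Embeddings of fields\<close>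

lemma field_embedding_0: "field_embedding emb \<Longrightarrow> emb 0 = 0"
  unfolding field_embedding_def by (metis add_cancel_right_left)

lemma field_embedding_diff: "field_embedding emb \<Longrightarrow> emb (a - b) = emb a - emb b"
  unfolding field_embedding_def by (metis add_diff_cancel diff_add_cancel)

lemma field_embedding_sum: "field_embedding emb \<Longrightarrow> emb (sum f A) = (\<Sum>x\<in>A. emb (f x))"
  by (induction A rule: infinite_finite_induct)
     (auto simp: field_embedding_0, auto simp: field_embedding_def)

lemma field_embedding_eq_0_iff: "field_embedding emb \<Longrightarrow> emb a = 0 \<longleftrightarrow> a = 0"
  by (metis field_embedding_0 field_embedding_def mult_zero_left right_inverse zero_neq_one)

lemma length_GRS_rows [simp]: "length (GRS_rows K M \<omega> v) = K - M + 1"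
  by (simp add: GRS_rows_def del: upt_Suc)

lemma length_GRS_answer [simp]: "length (GRS_answer K emb (GRS_rows K M \<omega> v) b X) = K - M + 1"
  by (simp add: GRS_answer_def)

lemma nth_GRS_rows: "i \<le> K - M \<Longrightarrow> j \<in> {1..K} \<Longrightarrow> GRS_rows K M \<omega> v ! i ! (j - 1) = v j * \<omega> j ^ i"
  by (auto simp: GRS_rows_def simp del: upt_Suc)

lemma nth_GRS_answer:
  assumes "i \<le> K - M"
  shows "GRS_answer K emb (GRS_rows K M \<omega> v) b X ! i = (\<Sum>j=1..K. emb (v j * \<omega> j ^ i) * X j)"
  using assms by (simp add: GRS_answer_def nth_GRS_rows del: One_nat_def cong: sum.cong_simp)

text \<open>Exchanging the two sums collects the powers of \<open>\<omega> j\<close> into a value of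
  \<open>p\<close>. The degree bound is what lets K - M + 1 answers suffice.\<close>

lemma GRS_answer_combination:
  assumes emb: "field_embedding emb" and deg: "degree p \<le> K - M"
  shows "(\<Sum>i\<le>K - M. emb (coeff p i) * GRS_answer K emb (GRS_rows K M \<omega> v) b X ! i) =
    (\<Sum>j=1..K. emb (v j * poly p (\<omega> j)) * X j)"
proof -
  have hom: "emb (x * y) = emb x * emb y" for x y
    using emb by (simp add: field_embedding_def)
  have "poly p x = (\<Sum>i\<le>K - M. coeff p i * x ^ i)" for x
    unfolding poly_altdef using deg by (intro sum.mono_neutral_left) (auto simp: coeff_eq_0)
  then have "v j * poly p (\<omega> j) = (\<Sum>i\<le>K - M. coeff p i * (v j * \<omega> j ^ i))" for j
    by (simp add: sum_distrib_left mult.left_commute)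
  then have "emb (v j * poly p (\<omega> j)) * X j =
      (\<Sum>i\<le>K - M. emb (coeff p i) * (emb (v j * \<omega> j ^ i) * X j))" for j
    by (simp add: field_embedding_sum[OF emb] hom[of "coeff p _"] sum_distrib_right mult.assoc)
  then have "(\<Sum>j=1..K. emb (v j * poly p (\<omega> j)) * X j) =
      (\<Sum>j=1..K. \<Sum>i\<le>K - M. emb (coeff p i) * (emb (v j * \<omega> j ^ i) * X j))"
    by (rule sum.cong[OF refl])
  also have "\<dots> = (\<Sum>i\<le>K - M. \<Sum>j=1..K. emb (coeff p i) * (emb (v j * \<omega> j ^ i) * X j))"
    by (rule sum.swap)
  finally show ?thesis by (simp add: nth_GRS_answer sum_distrib_left)
qed

text \<open>Distinctness of the points rules out further roots. This justifies the divisions in the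
  query.\<close>

lemma poly_GRS_poly_eq_0_iff:
  assumes "inj_on \<omega> {1..K}" and "j \<in> {1..K}"
  shows "poly (GRS_poly K \<omega> S) (\<omega> j) = 0 \<longleftrightarrow> j \<notin> S"
proof -
  have "\<omega> j = \<omega> i \<longleftrightarrow> j = i" if "i \<in> {1..K}" for i
    using assms that by (simp add: inj_on_eq_iff)
  then show ?thesis using assms(2) by (auto simp: GRS_poly_def poly_prod)
qed

lemma degree_GRS_poly:
  fixes \<omega> :: "nat \<Rightarrow> 'f::field"
  assumes "S \<subseteq> {1..K}" shows "degree (GRS_poly K \<omega> S) = K - card S"
proof -
  have "degree (GRS_poly K \<omega> S) = (\<Sum>i\<in>{1..K} - S. degree [:- \<omega> i, 1:])"
    unfolding GRS_poly_def by (rule degree_prod_eq_sum_degree) auto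
  also have "\<dots> = K - card S"
    using assms by (simp add: card_Diff_subset finite_subset)
  finally show ?thesis .
qed

section \<open>The laws of the query and of the answer\<close>

lemma coef_nth:
  assumes "finite S" and "length C = card S" and "k < card S"
  shows "coef S C (sorted_list_of_set S ! k) = C ! k"
  using assms by (simp add: coef_def map_of_zip_nth)

lemma coef_nonzero:
  assumes "finite S" and "C \<in> coef_seqs (card S)" and "j \<in> S"
  shows "coef S C j \<noteq> 0"
proof -
  obtain k where "k < card S" "j = sorted_list_of_set S ! k"
    using assms(1,3) by (metis in_set_conv_nth length_sorted_list_of_set set_sorted_list_of_set)
  moreover from this have "C ! k \<noteq> 0"
    using assms(2) by (auto simp: coef_seqs_def subset_iff)
  ultimately show ?thesis using assms by (simp add: coef_nth coef_seqs_def)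
qed

lemma finite_coef_seqs [simp]: "finite (coef_seqs M :: 'f::{finite,field} list set)"
  unfolding coef_seqs_def using finite_lists_length_eq[of "UNIV - {0 :: 'f}" M]
  by (simp add: conj_commute)

lemma coef_seqs_nonempty [simp]: "coef_seqs M \<noteq> ({} :: 'f::field list set)"
proof -
  have "replicate M (1 :: 'f) \<in> coef_seqs M" by (auto simp: coef_seqs_def)
  then show ?thesis by blast
qed

text \<open>Reading a sequence along the increasing enumeration of \<open>S\<close> is a bijection
  onto the families that are nonzero on \<open>S\<close> and take the default 0 elsewhere. The
  product form allows the coefficient at \<open>W\<close> to be split off.\<close>

lemma map_pmf_coef:
  fixes S :: "nat set"
  assumes "finite S"
  shows "map_pmf (\<lambda>C j. if j \<in> S then coef S C j else 0) (pmf_of_set (coef_seqs (card S))) =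
    Pi_pmf S 0 (\<lambda>_. pmf_of_set (UNIV - {0 :: 'f::{finite,field}}))"
proof -
  let ?A = "PiE_dflt S 0 (\<lambda>_. UNIV - {0 :: 'f})"
  have "bij_betw (\<lambda>C j. if j \<in> S then coef S C j else 0) (coef_seqs (card S)) ?A"
  proof (rule bij_betw_byWitness[where f' = "\<lambda>f. map f (sorted_list_of_set S)"])
    show "\<forall>C :: 'f list\<in>coef_seqs (card S).
        map (\<lambda>j. if j \<in> S then coef S C j else 0) (sorted_list_of_set S) = C"
    proof
      fix C :: "'f list" assume "C \<in> coef_seqs (card S)"
      then have len: "length C = card S" by (simp add: coef_seqs_def)
      show "map (\<lambda>j. if j \<in> S then coef S C j else 0) (sorted_list_of_set S) = C"
        using assms len nth_mem[of _ "sorted_list_of_set S"]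
        by (intro nth_equalityI) (auto simp: coef_nth)
    qed
    show "\<forall>f\<in>?A. (\<lambda>j. if j \<in> S then coef S (map f (sorted_list_of_set S)) j else 0) = f"
      using assms by (auto simp: coef_def map_of_zip_map PiE_dflt_def fun_eq_iff)
    show "(\<lambda>C j. if j \<in> S then coef S C j else 0) ` coef_seqs (card S) \<subseteq> ?A"
      using assms by (auto simp: PiE_dflt_def coef_nonzero)
    show "(\<lambda>f. map f (sorted_list_of_set S)) ` ?A \<subseteq> coef_seqs (card S)"
      using assms by (auto simp: PiE_dflt_def coef_seqs_def)
  qed
  moreover have "UNIV - {0 :: 'f} \<noteq> {}" by (rule nonzero_set_nonempty)
  ultimately show ?thesis using assms
    by (subst Pi_pmf_of_set) (auto intro!: map_pmf_of_set_bij_betw)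
qed

text \<open>Each \<open>x\<close> in \<open>A\<close> is reached from the \<open>card A - 1\<close>
  first choices different from it, each path having probability 1 / (\<open>card A\<close> *
  (\<open>card A - 1\<close>)).\<close>

lemma bind_pmf_of_set_remove:
  fixes A :: "'a set"
  assumes "finite A" and "2 \<le> card A"
  shows "bind_pmf (pmf_of_set A) (\<lambda>a. pmf_of_set (A - {a})) = pmf_of_set A"
proof (rule pmf_eqI)
  fix x
  have A: "A \<noteq> {}" using assms by auto
  have ne: "A - {a} \<noteq> {}" for a
  proof
    assume "A - {a} = {}" then have "card A \<le> card {a}" by (intro card_mono) auto
    then show False using assms by simp
  qed
  have "pmf (bind_pmf (pmf_of_set A) (\<lambda>a. pmf_of_set (A - {a}))) x =
     (\<Sum>a\<in>A. indicator (A - {a}) x / (real (card A) - 1)) / card A"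
    using assms A ne by (auto simp: pmf_bind integral_pmf_of_set card_Diff_singleton of_nat_diff intro!: sum.cong)
  \<comment> \<open>The term for \<open>a = x\<close> vanishes, and the others do not depend on
    \<open>a\<close>.\<close>
  also have "(\<Sum>a\<in>A. indicator (A - {a}) x / (real (card A) - 1)) =
      (\<Sum>a\<in>A - {x}. indicator A x / (real (card A) - 1))"
    using assms(1) by (intro sum.mono_neutral_cong_right) (auto simp: indicator_def)
  also have "\<dots> / card A = pmf (pmf_of_set A) x"
    using assms A by (auto simp: indicator_def card_Diff_singleton of_nat_diff)
  finally show "pmf (bind_pmf (pmf_of_set A) (\<lambda>a. pmf_of_set (A - {a}))) x = pmf (pmf_of_set A) x" .
qed

lemma GRS_rows_cong: "(\<And>j. j \<in> {1..K} \<Longrightarrow> v j = v' j) \<Longrightarrow> GRS_rows K M \<omega> v = GRS_rows K M \<omega> v'"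
  by (auto simp: GRS_rows_def)

text \<open>Privacy in essence: the right-hand side mentions neither \<open>W\<close> nor
  \<open>S\<close>. Averaging over \<open>C\<close> is essential, since a fixed \<open>C\<close>
  fixes the entries of \<open>v\<close> on \<open>S\<close> other than the one at
  \<open>W\<close>.\<close>

lemma bind_GRS_query:
  fixes \<omega> :: "nat \<Rightarrow> 'f::{finite,field}"
  assumes S: "S \<subseteq> {1..K}" and W: "W \<in> S" and \<omega>: "inj_on \<omega> {1..K}" and q: "3 \<le> CARD('f)"
  shows "bind_pmf (pmf_of_set (coef_seqs (card S))) (GRS_query K M \<omega> W S) =
    map_pmf (GRS_rows K M \<omega>) (Pi_pmf {1..K} 0 (\<lambda>_. pmf_of_set (UNIV - {0})))"
proof -
  define U where "U = pmf_of_set (UNIV - {0 :: 'f})"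
  define T where "T = S - {W}"
  define R where "R = {1..K} - S"
  define d where "d j = poly (GRS_poly K \<omega> S) (\<omega> j)" for j
  define D where "D z = (\<lambda>j. if j \<in> S then z j / d j else z j)" for z :: "nat \<Rightarrow> 'f"
  \<comment> \<open>The query draw as a function of the family \<open>y\<close> of side-information
    coefficients, with all divisions postponed to \<open>D\<close>.\<close>
  define h where "h y = do {
      c \<leftarrow> pmf_of_set (UNIV - {0, y W});
      u \<leftarrow> Pi_pmf R 0 (\<lambda>_. U);
      return_pmf (GRS_rows K M \<omega> (D (\<lambda>j. if j \<in> S then (y(W := c)) j else u j)))}" for y :: "nat \<Rightarrow> 'f"
  have fin: "finite S" using S finite_subset by blast
  have S_eq: "S = insert W T" "finite T" "W \<notin> T" using W fin by (auto simp: T_def)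
  have d: "d j \<noteq> 0" if "j \<in> S" for j
    unfolding d_def using that S poly_GRS_poly_eq_0_iff[OF \<omega>] by blast
  \<comment> \<open>Here \<open>3 \<le> CARD('f)\<close> enters: at least two nonzero elements are
    available.\<close>
  have U: "bind_pmf U (\<lambda>y. pmf_of_set (UNIV - {0, y})) = U"
    using bind_pmf_of_set_remove[of "UNIV - {0 :: 'f}"] q
    by (simp add: U_def card_Diff_singleton Diff_insert2[symmetric] insert_commute)
  have "GRS_query K M \<omega> W S = (\<lambda>C. h (\<lambda>j. if j \<in> S then coef S C j else 0))"
    unfolding fun_eq_iff GRS_query_def h_def Let_def U_def R_def using W
    by (auto intro!: bind_pmf_cong refl arg_cong[of _ _ return_pmf] GRS_rows_cong simp: D_def d_def)
  then have "bind_pmf (pmf_of_set (coef_seqs (card S))) (GRS_query K M \<omega> W S) =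
      bind_pmf (map_pmf (\<lambda>C j. if j \<in> S then coef S C j else 0) (pmf_of_set (coef_seqs (card S)))) h"
    by (simp add: bind_map_pmf)
  also have "\<dots> = bind_pmf (Pi_pmf S 0 (\<lambda>_. U)) h"
    by (simp only: map_pmf_coef[OF fin] U_def)
  also have "\<dots> = do {y \<leftarrow> U; f \<leftarrow> Pi_pmf T 0 (\<lambda>_. U); h (f(W := y))}"
    unfolding S_eq(1) by (subst Pi_pmf_insert') (simp_all add: S_eq bind_assoc_pmf bind_return_pmf)
  \<comment> \<open>The update at \<open>W\<close> by \<open>c\<close> overwrites the one by
    \<open>y\<close>, so \<open>y\<close> survives only as the value excluded for \<open>c\<close>.
    Drawing it just before \<open>c\<close> makes the fact \<open>U\<close> applicable.\<close>
  also have "\<dots> = do {f \<leftarrow> Pi_pmf T 0 (\<lambda>_. U); y \<leftarrow> U; c \<leftarrow> pmf_of_set (UNIV - {0, y});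
      u \<leftarrow> Pi_pmf R 0 (\<lambda>_. U);
      return_pmf (GRS_rows K M \<omega> (D (\<lambda>j. if j \<in> S then (f(W := c)) j else u j)))}"
    by (subst bind_commute_pmf) (simp add: h_def cong: if_cong)
  also have "\<dots> = do {f \<leftarrow> Pi_pmf T 0 (\<lambda>_. U); c \<leftarrow> U; u \<leftarrow> Pi_pmf R 0 (\<lambda>_. U);
      return_pmf (GRS_rows K M \<omega> (D (\<lambda>j. if j \<in> S then (f(W := c)) j else u j)))}"
    by (subst (2) U[symmetric]) (simp add: bind_assoc_pmf)
  also have "\<dots> = do {f \<leftarrow> Pi_pmf S 0 (\<lambda>_. U); u \<leftarrow> Pi_pmf R 0 (\<lambda>_. U);
      return_pmf (GRS_rows K M \<omega> (D (\<lambda>j. if j \<in> S then f j else u j)))}"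
    unfolding S_eq(1)
    by (subst bind_commute_pmf, subst Pi_pmf_insert')
       (simp_all add: S_eq(2,3) bind_assoc_pmf bind_return_pmf)
  also have "\<dots> = map_pmf (GRS_rows K M \<omega>) (map_pmf D (Pi_pmf (S \<union> R) 0 (\<lambda>_. U)))"
    using fin by (subst Pi_pmf_union)
      (auto simp: R_def pair_pmf_def map_pmf_def bind_assoc_pmf bind_return_pmf)
  also have "S \<union> R = {1..K}" using S by (auto simp: R_def)
  \<comment> \<open>Scaling coordinates by nonzero constants permutes the vectors with nonzero
    entries, so their uniform law is preserved.\<close>
  also have "map_pmf D (Pi_pmf {1..K} 0 (\<lambda>_. U)) = Pi_pmf {1..K} 0 (\<lambda>_. U)"
  proof -
    let ?A = "PiE_dflt {1..K} 0 (\<lambda>_. UNIV - {0 :: 'f})"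
    have "bij_betw D ?A ?A"
      by (rule bij_betw_byWitness[where f' = "\<lambda>z j. if j \<in> S then z j * d j else z j"])
         (use S d in \<open>auto simp: D_def PiE_dflt_def fun_eq_iff split: if_splits\<close>)
    moreover have "Pi_pmf {1..K} 0 (\<lambda>_. U) = pmf_of_set ?A"
      unfolding U_def by (rule Pi_pmf_of_set) (simp, simp, rule nonzero_set_nonempty)
    moreover have "?A \<noteq> {}"
      unfolding PiE_dflt_empty_iff using nonzero_set_nonempty[where 'f = 'f] by blast
    moreover have "finite ?A" by (rule finite_PiE_dflt) auto
    ultimately show ?thesis by (simp add: map_pmf_of_set_bij_betw)
  qed
  finally show ?thesis by (simp add: U_def)
qed

text \<open>Extracts from the support of the query what decoding and the law of the answer
  use.\<close>

lemma set_GRS_query: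
  fixes \<omega> :: "nat \<Rightarrow> 'f::{finite,field}"
  assumes S: "S \<subseteq> {1..K}" and W: "W \<in> S" and C: "C \<in> coef_seqs (card S)"
    and \<omega>: "inj_on \<omega> {1..K}" and q: "3 \<le> CARD('f)" and Q: "Q \<in> set_pmf (GRS_query K M \<omega> W S C)"
  obtains c v where "Q = GRS_rows K M \<omega> v" "c \<noteq> coef S C W" "\<forall>j\<in>{1..K}. v j \<noteq> 0"
    "\<forall>j\<in>S. v j = (if j = W then c else coef S C j) / poly (GRS_poly K \<omega> S) (\<omega> j)"
proof -
  \<comment> \<open>A third field element exists, so the draw of \<open>c\<close> is from a nonempty
    set and its support is that set.\<close>
  have ne: "UNIV - {0, a} \<noteq> {}" for a :: 'f
  proof
    assume "UNIV - {0, a} = {}"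
    then have "CARD('f) \<le> card {0, a}" by (intro card_mono) auto
    also have "\<dots> \<le> 2" by (simp add: card_insert_if)
    finally show False using q by simp
  qed
  have ne0: "UNIV - {0 :: 'f} \<noteq> {}" by (rule nonzero_set_nonempty)
  obtain c u where c: "c \<in> UNIV - {0, coef S C W}"
    and u: "u \<in> set_pmf (Pi_pmf ({1..K} - S) 0 (\<lambda>_. pmf_of_set (UNIV - {0 :: 'f})))"
    and Q': "Q = GRS_rows K M \<omega> (\<lambda>j. if j = W then c / poly (GRS_poly K \<omega> S) (\<omega> W)
                  else if j \<in> S then coef S C j / poly (GRS_poly K \<omega> S) (\<omega> j) else u j)"
    using Q unfolding GRS_query_def Let_def set_bind_pmf set_return_pmf set_pmf_of_set[OF ne finite]
    by blast
  have "u j \<noteq> 0" if "j \<in> {1..K} - S" for j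
    using u that ne0 by (auto simp: set_Pi_pmf PiE_dflt_def set_pmf_of_set)
  moreover have "coef S C j \<noteq> 0" if "j \<in> S" for j
    using coef_nonzero[OF _ C that] S finite_subset by blast
  ultimately show ?thesis
    using c W S poly_GRS_poly_eq_0_iff[OF \<omega>, of _ S] by (intro that[OF Q', of c]) auto
qed

lemma GRS_answer_uniform:
  fixes emb :: "'f::field \<Rightarrow> 'e::{finite,field}" and \<omega> :: "nat \<Rightarrow> 'f"
  assumes emb: "field_embedding emb" and \<omega>: "inj_on \<omega> {1..K}" and M: "1 \<le> M" "M \<le> K"
    and v: "\<forall>j\<in>{1..K}. v j \<noteq> 0"
  shows "map_pmf (GRS_answer K emb (GRS_rows K M \<omega> v) b) (messages K) =
    pmf_of_set {xs. length xs = K - M + 1}"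
proof -
  define n where "n = K - M + 1"
  define T where "T = {1..n}"
  define R where "R = {n + 1..K}"
  define L where "L = {xs :: 'e list. length xs = n}"
  let ?A = "PiE_dflt T 0 (\<lambda>_. UNIV :: 'e set)"
  let ?ans = "GRS_answer K emb (GRS_rows K M \<omega> v) b"
  have TR: "{1..K} = T \<union> R" "T \<inter> R = {}" "finite T" "finite R" using M by (auto simp: T_def R_def n_def)
  have card: "card L = card ?A" "finite L" "finite ?A"
    using card_lists_length_eq[of "UNIV :: 'e set" n] finite_lists_length_eq[of "UNIV :: 'e set" n]
    by (auto simp: L_def card_PiE_dflt T_def)
  have bij: "bij_betw (\<lambda>f. ?ans (\<lambda>x. if x \<in> T then f x else g x)) ?A L" for g
  proof -
    have "inj_on (\<lambda>f. ?ans (\<lambda>x. if x \<in> T then f x else g x)) ?A"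
    proof (rule inj_onI)
      fix f f' assume f: "f \<in> ?A" "f' \<in> ?A"
        and eq: "?ans (\<lambda>x. if x \<in> T then f x else g x) = ?ans (\<lambda>x. if x \<in> T then f' x else g x)"
      show "f = f'"
      proof
        fix k
        show "f k = f' k"
        proof (cases "k \<in> T")
          case True
          then have k: "k \<in> {1..K}" using TR by blast
          \<comment> \<open>A Lagrange polynomial without normalization, of degree n - 1 = K - M.
            Its values at the points outside \<open>T\<close> are harmless, because both message
            vectors equal \<open>g\<close> there.\<close>
          define p where "p = (\<Prod>i\<in>T - {k}. [:- \<omega> i, 1:])"
          have "degree p = (\<Sum>i\<in>T - {k}. degree [:- \<omega> i, 1:])"
            unfolding p_def by (rule degree_prod_eq_sum_degree) auto
          then have deg: "degree p \<le> K - M"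
            using True by (simp add: T_def n_def)
          have p: "poly p (\<omega> j) = 0 \<longleftrightarrow> j \<noteq> k" if "j \<in> T" for j
            using \<omega> that True TR by (auto simp: p_def poly_prod inj_on_def)
          have "(\<Sum>j=1..K. emb (v j * poly p (\<omega> j)) * (if j \<in> T then f j else g j)) =
             (\<Sum>j=1..K. emb (v j * poly p (\<omega> j)) * (if j \<in> T then f' j else g j))"
            unfolding GRS_answer_combination[OF emb deg, symmetric, where b = b] eq ..
          then have "(\<Sum>j=1..K. emb (v j * poly p (\<omega> j)) * (if j \<in> T then f j else g j) -
             emb (v j * poly p (\<omega> j)) * (if j \<in> T then f' j else g j)) = 0"
            unfolding sum_subtractf by simp
          also have "(\<Sum>j=1..K. emb (v j * poly p (\<omega> j)) * (if j \<in> T then f j else g j) -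
             emb (v j * poly p (\<omega> j)) * (if j \<in> T then f' j else g j)) =
             (\<Sum>j=1..K. emb (v j * poly p (\<omega> j)) * (if j \<in> T then f j - f' j else 0))"
            by (intro sum.cong refl) (simp add: right_diff_distrib)
          also have "\<dots> =
             (\<Sum>j\<in>{k}. emb (v j * poly p (\<omega> j)) * (f j - f' j))"
            using k True p by (intro sum.mono_neutral_cong_right)
              (auto simp: field_embedding_eq_0_iff[OF emb])
          finally show ?thesis
            using p[OF True] v k by (auto simp: field_embedding_eq_0_iff[OF emb])
        qed (use f in \<open>auto simp: PiE_dflt_def\<close>)
      qed
    qed
    moreover have "(\<lambda>f. ?ans (\<lambda>x. if x \<in> T then f x else g x)) ` ?A \<subseteq> L"
      by (auto simp: L_def n_def)
    ultimately show ?thesis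
      unfolding bij_betw_def using card by (simp add: card_image card_subset_eq)
  qed
  have "map_pmf ?ans (messages K) = do {
     g \<leftarrow> Pi_pmf R 0 (\<lambda>_. pmf_of_set UNIV); f \<leftarrow> Pi_pmf T 0 (\<lambda>_. pmf_of_set UNIV);
     return_pmf (?ans (\<lambda>x. if x \<in> T then f x else g x))}"
    unfolding messages_def TR(1)
    by (subst Pi_pmf_union[OF TR(3,4,2)], subst bind_commute_pmf)
       (simp add: pair_pmf_def map_pmf_def bind_assoc_pmf bind_return_pmf)
  \<comment> \<open>With \<open>g\<close> drawn first, the bijection applies for each
    \<open>g\<close> and yields the same uniform law.\<close>
  also have "\<dots> = do {g \<leftarrow> Pi_pmf R 0 (\<lambda>_. pmf_of_set (UNIV :: 'e set)); pmf_of_set L}"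
    unfolding map_pmf_def[symmetric]
    using map_pmf_of_set_bij_betw[OF bij] card
    by (subst (2) Pi_pmf_of_set) (auto simp: TR)
  finally show ?thesis by (simp add: L_def n_def)
qed

section \<open>Finite supports and conditioning on a sure event\<close>

lemma finite_set_Pi_pmf:
  assumes "finite A" and "\<And>x. x \<in> A \<Longrightarrow> finite (set_pmf (p x))"
  shows "finite (set_pmf (Pi_pmf A d p))"
  by (rule finite_subset[OF set_Pi_pmf_subset'[OF assms(1)]]) (use assms in auto)

lemma finite_M_subsets [simp]: "finite (M_subsets K M)"
  by (simp add: M_subsets_def)

lemma M_subsets_nonempty: "M \<le> K \<Longrightarrow> M_subsets K M \<noteq> {}"
  using obtain_subset_with_card_n[of M "{1..K}"] by (auto simp: M_subsets_def)

lemma cond_pmf_eq_self: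
  assumes "set_pmf p \<subseteq> A" shows "cond_pmf p A = p"
proof -
  have ne: "set_pmf p \<inter> A \<noteq> {}" using assms set_pmf_not_empty[of p] by blast
  have "measure_pmf.prob p A = 1"
    using assms by (subst measure_pmf.prob_eq_1) (auto simp: AE_measure_pmf_iff)
  then show ?thesis
    using assms by (intro pmf_eqI) (auto simp: pmf_cond[OF ne] set_pmf_iff)
qed

section \<open>The protocol under Model II\<close>

text \<open>The bound 3 on the field size guarantees a choice of \<open>c\<close> different from 0
  and from the coefficient at \<open>W\<close>. The degree of the extension enters only in the
  rate.\<close>

locale modified_GRS =
  fixes K M :: nat
    and emb :: "'f::{finite,field} \<Rightarrow> 'e::{finite,field}"
    and \<omega> :: "nat \<Rightarrow> 'f"
  assumes M: "2 \<le> M" "M \<le> K" and q: "3 \<le> CARD('f)"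
    and emb: "field_embedding emb" and \<omega>: "inj_on \<omega> {1..K}"
begin

abbreviation "P \<equiv> modified_specialized_GRS K M emb \<omega>"

lemma M_subsetsD:
  assumes "S \<in> M_subsets K M"
  shows "S \<subseteq> {1..K}" "card S = M" "finite S" "S \<noteq> {}"
  using assms M by (auto simp: M_subsets_def intro: finite_subset)

lemma set_model_II:
  assumes "(W, S, C, X, Q) \<in> set_pmf (model_II K M P)"
  shows "S \<in> M_subsets K M" "W \<in> S" "C \<in> coef_seqs M" "Q \<in> set_pmf (GRS_query K M \<omega> W S C)"
  using assms M_subsetsD(3,4) M_subsets_nonempty[OF M(2)]
  by (auto simp: model_II_def modified_specialized_GRS_def)

lemma finite_model_II: "finite (set_pmf (model_II K M P))"
proof -
  have "finite (set_pmf (messages K :: (nat \<Rightarrow> 'e) pmf))"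
    and "finite (set_pmf (GRS_query K M \<omega> W S C))" for W S C
    by (simp_all add: messages_def GRS_query_def Let_def finite_set_Pi_pmf)
  then show ?thesis
    using M_subsetsD(3,4) M_subsets_nonempty[OF M(2)]
    by (auto simp: model_II_def modified_specialized_GRS_def)
qed

lemma recoverable: "recoverable K M emb P"
  unfolding recoverable_def
proof (rule bit_cond_entropy_eq_0[OF finite_model_II])
  \<comment> \<open>The decoder. It recovers \<open>c\<close> from the query: the first row has
    exponent 0, position \<open>W - 1\<close> holds the entry of index \<open>W\<close>, and this
    entry times the value of the polynomial at \<open>\<omega> W\<close> is
    \<open>c\<close>.\<close>
  let ?f = "\<lambda>(A, Q, b, Y, W, S, C).
    ((\<Sum>i\<le>K - M. emb (coeff (GRS_poly K \<omega> S) i) * A ! i) - Y) /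
    emb (Q ! 0 ! (W - 1) * poly (GRS_poly K \<omega> S) (\<omega> W) - coef S C W)"
  fix z assume "z \<in> set_pmf (model_II K M P)"
  moreover obtain W S C X Q where z: "z = (W, S, C, X, Q)" by (cases z)
  ultimately have S: "S \<in> M_subsets K M" and W: "W \<in> S" and C: "C \<in> coef_seqs M"
    and Q: "Q \<in> set_pmf (GRS_query K M \<omega> W S C)"
    using set_model_II by blast+
  let ?p = "GRS_poly K \<omega> S"
  note S = M_subsetsD[OF S]
  obtain c v where Q: "Q = GRS_rows K M \<omega> v" and c: "c \<noteq> coef S C W"
    and v: "\<forall>j\<in>S. v j = (if j = W then c else coef S C j) / poly ?p (\<omega> j)"
    using set_GRS_query[OF S(1) W _ \<omega> q Q] C S(2) by blast
  have p: "poly ?p (\<omega> j) = 0 \<longleftrightarrow> j \<notin> S" if "j \<in> {1..K}" for j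
    by (rule poly_GRS_poly_eq_0_iff[OF \<omega> that])
  have vp: "v j * poly ?p (\<omega> j) = (if j = W then c else coef S C j)" if "j \<in> S" for j
    using that p S(1) v by auto
  have "(\<Sum>i\<le>K - M. emb (coeff ?p i) * GRS_answer K emb Q (W \<in> S) X ! i) =
      (\<Sum>j=1..K. emb (v j * poly ?p (\<omega> j)) * X j)"
    unfolding Q using S by (intro GRS_answer_combination[OF emb]) (simp add: degree_GRS_poly)
  \<comment> \<open>Messages outside \<open>S\<close> drop out because their points are roots of the
    polynomial.\<close>
  also have "\<dots> = (\<Sum>j\<in>S. emb (if j = W then c else coef S C j) * X j)"
    using S(1,3) p vp
    by (intro sum.mono_neutral_cong_right) (auto simp: field_embedding_eq_0_iff[OF emb])
  also have "\<dots> = emb c * X W + (\<Sum>j\<in>S - {W}. emb (coef S C j) * X j)"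
    using S(3) W by (subst sum.remove[OF _ W]) (auto intro!: sum.cong)
  also have "\<dots> - side_info emb S C X = emb (c - coef S C W) * X W"
    unfolding side_info_def using S(3) W
    by (subst sum.remove[OF _ W]) (auto simp: field_embedding_diff[OF emb] algebra_simps)
  finally have *: "(\<Sum>i\<le>K - M. emb (coeff ?p i) * GRS_answer K emb Q (W \<in> S) X ! i) -
      side_info emb S C X = emb (c - coef S C W) * X W" .
  have "Q ! 0 ! (W - 1) = v W"
    unfolding Q using W S(1) by (subst nth_GRS_rows) auto
  then have "Q ! 0 ! (W - 1) * poly ?p (\<omega> W) - coef S C W = c - coef S C W"
    using vp[OF W] by simp
  moreover have "emb (c - coef S C W) \<noteq> 0"
    using c by (simp add: field_embedding_eq_0_iff[OF emb])
  ultimately show "(case z of (W, S, C, X, Q) \<Rightarrow> X W) =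
      ?f (case z of (W, S, C, X, Q) \<Rightarrow>
        (answer P Q (W \<in> S) X, Q, W \<in> S, side_info emb S C X, W, S, C))"
    using * by (simp add: z modified_specialized_GRS_def)
qed

text \<open>The messages integrate out. Averaging over \<open>C\<close> then leaves one query law
  common to all pairs \<open>(W, S)\<close>, so the joint law is a product.\<close>

lemma map_pmf_WS_query:
  "map_pmf (\<lambda>(W, S, C, X, Q). ((W, S), Q)) (model_II K M P) =
   pair_pmf (do {S \<leftarrow> pmf_of_set (M_subsets K M); W \<leftarrow> pmf_of_set S; return_pmf (W, S)})
     (map_pmf (GRS_rows K M \<omega>) (Pi_pmf {1..K} 0 (\<lambda>_. pmf_of_set (UNIV - {0}))))"
    (is "_ = pair_pmf _ ?D")
proof -
  have "map_pmf (\<lambda>(W, S, C, X, Q). ((W, S), Q)) (model_II K M P) = do {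
      S \<leftarrow> pmf_of_set (M_subsets K M);
      W \<leftarrow> pmf_of_set S;
      Q \<leftarrow> bind_pmf (pmf_of_set (coef_seqs M)) (GRS_query K M \<omega> W S);
      return_pmf ((W, S), Q)}"
    by (simp add: model_II_def modified_specialized_GRS_def map_bind_pmf bind_assoc_pmf)
  also have "\<dots> = do {
      S \<leftarrow> pmf_of_set (M_subsets K M); W \<leftarrow> pmf_of_set S; Q \<leftarrow> ?D; return_pmf ((W, S), Q)}"
  proof (intro bind_pmf_cong refl)
    fix S W
    assume "S \<in> set_pmf (pmf_of_set (M_subsets K M))" and W: "W \<in> set_pmf (pmf_of_set S)"
    then have "S \<in> M_subsets K M" using M_subsets_nonempty[OF M(2)] by simp
    note S = M_subsetsD[OF this]
    show "bind_pmf (pmf_of_set (coef_seqs M)) (GRS_query K M \<omega> W S) = ?D"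
      using bind_GRS_query[OF S(1) _ \<omega> q, of W M] W S by simp
  qed
  also have "\<dots> = pair_pmf (do {S \<leftarrow> pmf_of_set (M_subsets K M); W \<leftarrow> pmf_of_set S; return_pmf (W, S)}) ?D"
    by (simp add: pair_pmf_def bind_assoc_pmf bind_return_pmf)
  finally show ?thesis .
qed

lemma WS_private: "WS_private K M P"
  unfolding WS_private_def
proof (rule bit_cond_mutual_information_eq_0[OF finite_model_II, where z = True])
  show "rv_ind z = True" if "z \<in> set_pmf (model_II K M P)" for z
    using that set_model_II(2) by (cases z) (auto simp: rv_ind_def)
  show "map_pmf (\<lambda>z. (case z of (W, S, C, X, Q) \<Rightarrow> (W, S), case z of (W, S, C, X, Q) \<Rightarrow> Q))
      (model_II K M P) =
    pair_pmf (do {S \<leftarrow> pmf_of_set (M_subsets K M); W \<leftarrow> pmf_of_set S; return_pmf (W, S)})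
     (map_pmf (GRS_rows K M \<omega>) (Pi_pmf {1..K} 0 (\<lambda>_. pmf_of_set (UNIV - {0}))))"
    unfolding map_pmf_WS_query[symmetric] by (intro map_pmf_cong refl) auto
qed

text \<open>The messages are independent of the query and can be drawn last. Each query in the
  support gives the same uniform law, hence so does the mixture.\<close>

lemma map_pmf_rv_answer:
  "map_pmf (rv_answer P) (model_II K M P) = pmf_of_set {xs. length xs = K - M + 1}"
proof -
  have "map_pmf (rv_answer P) (model_II K M P) = do {
      S \<leftarrow> pmf_of_set (M_subsets K M);
      W \<leftarrow> pmf_of_set S;
      C \<leftarrow> pmf_of_set (coef_seqs M);
      Q \<leftarrow> GRS_query K M \<omega> W S C;
      map_pmf (GRS_answer K emb Q (W \<in> S)) (messages K)}"
    unfolding model_II_def modified_specialized_GRS_def rv_answer_def map_bind_pmf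
      map_pmf_def[of _ "messages K"]
    by (subst bind_commute_pmf) simp
  also have "\<dots> = do {
      S \<leftarrow> pmf_of_set (M_subsets K M);
      W \<leftarrow> pmf_of_set S;
      C \<leftarrow> pmf_of_set (coef_seqs M);
      Q \<leftarrow> GRS_query K M \<omega> W S C;
      pmf_of_set {xs. length xs = K - M + 1}}"
  proof (intro bind_pmf_cong refl)
    fix S W and C :: "'f list" and Q
    assume "S \<in> set_pmf (pmf_of_set (M_subsets K M))" and W: "W \<in> set_pmf (pmf_of_set S)"
      and C: "C \<in> set_pmf (pmf_of_set (coef_seqs M))" and Q: "Q \<in> set_pmf (GRS_query K M \<omega> W S C)"
    then have "S \<in> M_subsets K M" using M_subsets_nonempty[OF M(2)] by simp
    note S = M_subsetsD[OF this]
    obtain v where "Q = GRS_rows K M \<omega> v" "\<forall>j\<in>{1..K}. v j \<noteq> 0"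
      using set_GRS_query[OF S(1) _ _ \<omega> q Q] W C S by auto
    then show "map_pmf (GRS_answer K emb Q (W \<in> S)) (messages K) =
        pmf_of_set {xs. length xs = K - M + 1}"
      using GRS_answer_uniform[OF emb \<omega>] M by simp
  qed
  finally show ?thesis by simp
qed

text \<open>Model II draws \<open>W\<close> from \<open>S\<close>, so the conditioning event is
  sure; what remains is counting the sequences of length K - M + 1.\<close>

lemma bit_entropy_answer:
  "bit_entropy (cond_pmf (model_II K M P) {z. rv_ind z}) (rv_answer P) =
    real (K - M + 1) * log 2 CARD('e)"
proof -
  let ?L = "{xs :: 'e list. length xs = K - M + 1}"
  have "cond_pmf (model_II K M P) {z. rv_ind z} = model_II K M P"
    using set_model_II(2) by (intro cond_pmf_eq_self) (auto simp: rv_ind_def)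
  moreover have L: "finite ?L" "card ?L = CARD('e) ^ (K - M + 1)"
    using card_lists_length_eq[of "UNIV :: 'e set" "K - M + 1"]
      finite_lists_length_eq[of "UNIV :: 'e set" "K - M + 1"] by simp_all
  moreover have "?L \<noteq> {}" using Ex_list_of_length by blast
  ultimately show ?thesis
    using bit_entropy_uniform[OF finite_model_II map_pmf_rv_answer]
    by (simp only: of_nat_power log_nat_power zero_less_card_finite of_nat_0_less_iff
        not_False_eq_True simp_thms)
qed

end

text \<open>Each row of the query, indexed from 1, is itself a coefficient vector.\<close>

lemma scalar_linear_GRS: "scalar_linear K emb (modified_specialized_GRS K M emb \<omega>)"
  unfolding scalar_linear_def
proof (intro allI exI)
  fix Q b X
  show "answer (modified_specialized_GRS K M emb \<omega>) Q b X =
      map (\<lambda>a. \<Sum>j=1..K. emb (a j) * X j) (map (\<lambda>row j. row ! (j - 1)) Q)"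
    by (simp add: modified_specialized_GRS_def GRS_answer_def o_def)
qed

theorem lemma7:
  fixes K M q l :: nat
    and emb :: "'f::{finite,field} \<Rightarrow> 'e::{finite,field}"
    and \<omega> :: "nat \<Rightarrow> 'f"
  assumes "2 \<le> M" and "M \<le> K"
    and "primepow q" and "K \<le> q" and "3 \<le> q" and "1 \<le> l"
    and "CARD('f) = q" and "CARD('e) = q ^ l" and "field_embedding emb"
    and "inj_on \<omega> {1..K}"
  shows "PIR_PCSI_II_protocol K M emb (modified_specialized_GRS K M emb \<omega>) \<and>
    scalar_linear K emb (modified_specialized_GRS K M emb \<omega>) \<and>
    rate K M q l (modified_specialized_GRS K M emb \<omega>) = inverse (real (K - M + 1))"
proof -
  interpret modified_GRS K M emb \<omega>
    using assms by unfold_locales simp_all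
  have "log 2 (real CARD('e)) = real l * log 2 (real q)"
    using assms by (simp add: log_nat_power)
  \<comment> \<open>Each answer symbol carries exactly the entropy L of one message. Since L is
    nonzero, it cancels in the rate.\<close>
  moreover have "l \<noteq> 0" and "log 2 (real q) > 0"
    using assms by simp_all
  ultimately have "rate K M q l P = inverse (real (K - M + 1))"
    unfolding rate_def bit_entropy_answer by (simp add: inverse_eq_divide)
  then show ?thesis
    using recoverable WS_private scalar_linear_GRS by (simp add: PIR_PCSI_II_protocol_def)
qed

end
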